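(* Define $b(1)=1$ and $b(n)=n+\sum_m b(m)$ for $n>1$, the sum over all proper divisors $m$ of $n$ (positive divisors $m<n$). Let $p,q,r$ be distinct primes and $c,d,e$ positive integers. Then $$b(p^c)=2b(p^{c-1})+(p-1)p^{c-1},$$ $$b(p^cq^d)=2\big(b(p^{c-1}q^d)+b(p^cq^{d-1})-b(p^{c-1}q^{d-1})\big)+(p-1)(q-1)p^{c-1}q^{d-1},$$ $$b(p^cq^dr^e)=2\big(b(p^{c-1}q^dr^e)+b(p^cq^{d-1}r^e)+b(p^cq^dr^{e-1})-b(p^cq^{d-1}r^{e-1})-b(p^{c-1}q^dr^{e-1})-b(p^{c-1}q^{d-1}r^e)+b(p^{c-1}q^{d-1}r^{e-1})\big)+(p-1)(q-1)(r-1)p^{c-1}q^{d-1}r^{e-1}.$$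
   Context: $b(n)$ is called the sum of recursive divisors of $n$. *)

theory Defs
  imports Main "HOL-Computational_Algebra.Primes"
begin

text \<open>Only arguments \<open>n \<ge> 1\<close> are meaningful; the value at \<open>0\<close> is junk (it is \<open>0\<close>).\<close>

function recdiv_sum :: "nat \<Rightarrow> nat" where
  "recdiv_sum n =
     (if n = 1 then 1
      else n + (\<Sum>m\<in>{m. 0 < m \<and> m < n \<and> m dvd n}. recdiv_sum m))"
  by auto
termination
  by (relation "measure id") auto

declare recdiv_sum.simps [simp del]

end

theory Submission
  imports Defs
begin

text \<open>The recursion says that \<open>S(n) = (\<Sum>m | m dvd n. b m)\<close> equals \<open>2 b(n) - n\<close> for all
  \<open>n > 0\<close>. Taking the difference of \<open>S\<close> in the exponent of one prime leaves only the divisors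
  with full exponent at that prime, so the alternating differences over all primes of \<open>n\<close>
  (Moebius inversion) collapse to \<open>b(n)\<close>; substituting \<open>S(m) = 2 b(m) - m\<close> and solving for
  \<open>b(n)\<close> gives the three formulas.\<close>

text \<open>For \<open>n > 1\<close> the recursion makes the sum over proper divisors equal to b(n)
  - n, and the divisor \<open>n\<close> adds one more b(n). At \<open>n = 1\<close> both sides are
  1. Casting to \<open>int\<close> gives honest subtraction.\<close>

lemma sum_divisors_recdiv_sum:
  assumes "n > 0"
  shows "(\<Sum>m | m dvd n. int (recdiv_sum m)) = 2 * int (recdiv_sum n) - int n"
proof (cases "n = 1")
  case True
  then show ?thesis by (simp add: recdiv_sum.simps[of "Suc 0"])
next
  case False
  let ?A = "{m. 0 < m \<and> m < n \<and> m dvd n}"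
  have "{m. m dvd n} = insert n ?A"
    using assms by (auto dest: dvd_imp_le intro: Nat.gr0I)
  then have "(\<Sum>m | m dvd n. int (recdiv_sum m)) =
      int (recdiv_sum n) + (\<Sum>m\<in>?A. int (recdiv_sum m))"
    by simp
  moreover have "recdiv_sum n = n + (\<Sum>m\<in>?A. recdiv_sum m)"
    using False by (subst recdiv_sum.simps) simp
  ultimately show ?thesis
    by (simp flip: of_nat_sum)
qed

text \<open>Divisors of \<open>p ^ Suc a * k\<close> split by their exponent at \<open>p\<close>:
  those with exponent at most \<open>a\<close> divide \<open>p ^ a * k\<close>, the others are
  \<open>p ^ Suc a\<close> times a divisor of \<open>k\<close>.\<close>

lemma sum_divisors_prime_power_mult:
  fixes p k a :: nat and f :: "nat \<Rightarrow> 'a::comm_monoid_add"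
  assumes p: "prime p" and k: "\<not> p dvd k"
  shows "(\<Sum>m | m dvd p ^ Suc a * k. f m) =
    (\<Sum>m | m dvd p ^ a * k. f m) + (\<Sum>m | m dvd k. f (p ^ Suc a * m))"
proof -
  let ?g = "\<lambda>m. p ^ Suc a * m"
  have pos: "p > 0" "k > 0"
    using p k prime_gt_0_nat by (auto intro: Nat.gr0I)
  have "{m. m dvd p ^ Suc a * k} = {m. m dvd p ^ a * k} \<union> ?g ` {m. m dvd k}"
  proof (intro equalityI subsetI)
    fix m assume "m \<in> {m. m dvd p ^ Suc a * k}"
    then obtain u j where m: "m = u * j" "u dvd p ^ Suc a" "j dvd k"
      using division_decomp by blast
    then obtain i where i: "i \<le> Suc a" "u = p ^ i"
      using p divides_primepow_nat by blast
    show "m \<in> {m. m dvd p ^ a * k} \<union> ?g ` {m. m dvd k}"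
    proof (cases "i = Suc a")
      case True
      then show ?thesis using m i by blast
    next
      case False
      then have "u dvd p ^ a" using i by (simp add: le_imp_power_dvd)
      then show ?thesis using m by (simp add: mult_dvd_mono)
    qed
  next
    fix m assume "m \<in> {m. m dvd p ^ a * k} \<union> ?g ` {m. m dvd k}"
    then show "m \<in> {m. m dvd p ^ Suc a * k}"
      by (auto simp: mult.assoc)
  qed
  moreover have "{m. m dvd p ^ a * k} \<inter> ?g ` {m. m dvd k} = {}"
  proof -
    \<comment> \<open>A common element would, after cancelling \<open>p ^ a\<close>, force
      \<open>p\<close> to divide \<open>k\<close>.\<close>
    have False if "p ^ Suc a * j dvd p ^ a * k" for j
    proof -
      have "p ^ a * (p * j) dvd p ^ a * k"
        using that by (simp add: ac_simps)
      then have "p * j dvd k"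
        using pos by simp
      then show False
        using k dvd_mult_left by blast
    qed
    then show ?thesis by blast
  qed
  moreover have "inj_on ?g {m. m dvd k}"
    using pos by (auto simp: inj_on_def)
  ultimately show ?thesis
    using pos by (simp add: sum.union_disjoint sum.reindex)
qed

text \<open>The case \<open>k = 1\<close>, for a prime with no cofactor left: the only new divisor
  is \<open>p ^ Suc a\<close> itself.\<close>

lemma sum_divisors_prime_power:
  fixes p a :: nat and f :: "nat \<Rightarrow> 'a::comm_monoid_add"
  assumes "prime p"
  shows "(\<Sum>m | m dvd p ^ Suc a. f m) = (\<Sum>m | m dvd p ^ a. f m) + f (p ^ Suc a)"
  using sum_divisors_prime_power_mult[where p = p and k = 1 and a = a and f = f] assms by (simp add: prime_nat_iff)

theorem theorem6:
  fixes p q r c d e :: nat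
  assumes "prime p" "prime q" "prime r"
    and "p \<noteq> q" "p \<noteq> r" "q \<noteq> r"
    and "c > 0" "d > 0" "e > 0"
  defines "b \<equiv> \<lambda>n. int (recdiv_sum n)"
  shows "b (p ^ c) = 2 * b (p ^ (c - 1)) + (int p - 1) * int p ^ (c - 1)
    \<and> b (p ^ c * q ^ d) =
        2 * (b (p ^ (c - 1) * q ^ d) + b (p ^ c * q ^ (d - 1))
             - b (p ^ (c - 1) * q ^ (d - 1)))
        + (int p - 1) * (int q - 1) * int p ^ (c - 1) * int q ^ (d - 1)
    \<and> b (p ^ c * q ^ d * r ^ e) =
        2 * (b (p ^ (c - 1) * q ^ d * r ^ e) + b (p ^ c * q ^ (d - 1) * r ^ e)
             + b (p ^ c * q ^ d * r ^ (e - 1))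
             - b (p ^ c * q ^ (d - 1) * r ^ (e - 1))
             - b (p ^ (c - 1) * q ^ d * r ^ (e - 1))
             - b (p ^ (c - 1) * q ^ (d - 1) * r ^ e)
             + b (p ^ (c - 1) * q ^ (d - 1) * r ^ (e - 1)))
        + (int p - 1) * (int q - 1) * (int r - 1)
          * int p ^ (c - 1) * int q ^ (d - 1) * int r ^ (e - 1)"
proof -
  obtain c' d' e' where cde: "c = Suc c'" "d = Suc d'" "e = Suc e'"
    using assms(7-9)[THEN gr0_implies_Suc] by blast
  note pos = assms(1-3)[THEN prime_gt_0_nat]
  have ndvd: "\<not> p dvd q ^ i * r ^ j" "\<not> p dvd q ^ i" "\<not> q dvd r ^ j" for i j
    using assms(1-6) by (meson prime_dvd_mult_iff prime_dvd_power primes_dvd_imp_eq)+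
  \<comment> \<open>The summand \<open>f\<close> stays a parameter because a difference at one prime
    yields a divisor sum of a shifted function, to which the difference at the next prime
    applies.\<close>
  define S where "S f n = (\<Sum>m | m dvd n. f m)" for f :: "nat \<Rightarrow> int" and n
  have S_b: "S b n = 2 * b n - int n" if "n > 0" for n
    unfolding S_def b_def using sum_divisors_recdiv_sum[OF that] .
  have Sp: "S f (p ^ c * k) - S f (p ^ c' * k) = S (\<lambda>m. f (p ^ c * m)) k"
    if "\<not> p dvd k" for f k
    unfolding S_def cde using sum_divisors_prime_power_mult[OF assms(1) that, where f = f and a = c'] by simp
  have Sq: "S f (q ^ d * k) - S f (q ^ d' * k) = S (\<lambda>m. f (q ^ d * m)) k"
    if "\<not> q dvd k" for f k
    unfolding S_def cde using sum_divisors_prime_power_mult[OF assms(2) that, where f = f and a = d'] by simp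
  have Sp1: "S f (p ^ c) - S f (p ^ c') = f (p ^ c)" for f
    unfolding S_def cde using sum_divisors_prime_power[OF assms(1), where f = f and a = c'] by simp
  have Sq1: "S f (q ^ d) - S f (q ^ d') = f (q ^ d)" for f
    unfolding S_def cde using sum_divisors_prime_power[OF assms(2), where f = f and a = d'] by simp
  have Sr1: "S f (r ^ e) - S f (r ^ e') = f (r ^ e)" for f
    unfolding S_def cde using sum_divisors_prime_power[OF assms(3), where f = f and a = e'] by simp
  have 1: "S b (p ^ c) - S b (p ^ c') = b (p ^ c)"
    by (rule Sp1)
  \<comment> \<open>Each inner difference is taken at \<open>p\<close>, with a power of
    \<open>q\<close> as cofactor; the outer one is the difference at \<open>q\<close> of the shifted
    function.\<close>
  have 2: "(S b (p ^ c * q ^ d) - S b (p ^ c' * q ^ d))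
      - (S b (p ^ c * q ^ d') - S b (p ^ c' * q ^ d')) = b (p ^ c * q ^ d)"
    using Sq1[of "\<lambda>m. b (p ^ c * m)"] by (simp only: Sp[OF ndvd(2)])
  have 3: "((S b (p ^ c * (q ^ d * r ^ e)) - S b (p ^ c' * (q ^ d * r ^ e)))
        - (S b (p ^ c * (q ^ d' * r ^ e)) - S b (p ^ c' * (q ^ d' * r ^ e))))
      - ((S b (p ^ c * (q ^ d * r ^ e')) - S b (p ^ c' * (q ^ d * r ^ e')))
        - (S b (p ^ c * (q ^ d' * r ^ e')) - S b (p ^ c' * (q ^ d' * r ^ e'))))
      = b (p ^ c * (q ^ d * r ^ e))"
    using Sr1[of "\<lambda>m. b (p ^ c * (q ^ d * m))"]
    by (simp only: Sp[OF ndvd(1)] Sq[OF ndvd(3)])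
  \<comment> \<open>With these, the alternating sum of the terms \<open>int n\<close> from
    \<open>S_b\<close> factors into products such as (p - 1) p^c', the last summand of each
    formula.\<close>
  have powers: "int p ^ c = int p * int p ^ c'" "int q ^ d = int q * int q ^ d'"
      "int r ^ e = int r * int r ^ e'"
    by (simp_all add: cde)
  have preds: "c - 1 = c'" "d - 1 = d'" "e - 1 = e'"
    by (simp_all add: cde)
  have S_pqr: "S b (p ^ i * (q ^ j * r ^ k)) =
      2 * b (p ^ i * (q ^ j * r ^ k)) - int p ^ i * (int q ^ j * int r ^ k)" for i j k
    using S_b[of "p ^ i * (q ^ j * r ^ k)"] pos by simp
  have S_pq: "S b (p ^ i * q ^ j) = 2 * b (p ^ i * q ^ j) - int p ^ i * int q ^ j" for i j
    using S_pqr[of i j 0] by simp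
  have S_p: "S b (p ^ i) = 2 * b (p ^ i) - int p ^ i" for i
    using S_pq[of i 0] by simp
  show ?thesis
    \<comment> \<open>Reassociation makes the arguments of \<open>b\<close> match the right-nested
      ones in \<open>3\<close>. What remains is linear in the values of \<open>b\<close>.\<close>
    unfolding preds mult.assoc[of "p ^ i" "q ^ j" for i j]
    using 1[unfolded S_p powers] 2[unfolded S_pq powers] 3[unfolded S_pqr powers]
    by (intro conjI; simp only: algebra_simps)
qed

end
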